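(* Suppose $r<l=\min(m,n)$. Then $\mathcal M_{mn}^J$ is generated (as a semigroup) by $\Omega=\{X\in\mathcal M_{mn}:\operatorname{rank}(X)>r\}$. Further, any generating set for $\mathcal M_{mn}^J$ contains $\Omega$. If $|\mathbb F|=q<\infty$, then $$\operatorname{rank}(\mathcal M_{mn}^J)=|\Omega|=\sum_{s=r+1}^{l}\begin{bmatrix}m\\ s\end{bmatrix}_q\begin{bmatrix}n\\ s\end{bmatrix}_q\,q^{\binom s2}(q-1)^s[s]_q!.$$
   Context: Let $\mathbb F$ be a field, $m,n\geq1$ integers, and $0\leq r\leq\min(m,n)$. $\mathcal M_{kl}$ denotes the set of all $k\times l$ matrices over $\mathbb F$. Let $J=\begin{bmatrix}I_r&O\\O&O\end{bmatrix}\in\mathcal M_{nm}$ (an $n\times m$ matrix), and let $\mathcal M_{mn}^J$ be the semigroup with underlying set $\mathcal M_{mn}$ and operation $X\star Y=XJY$. For a matrix $X$, $\operatorname{rank}(X)$ is its usual rank; for a semigroup $S$, $\operatorname{rank}(S)$ is the minimum size of a generating set for $S$ (as a semigroup). $[s]_q!=\prod_{i=1}^s(1+q+\cdots+q^{i-1})$, and $\begin{bmatrix}k\\ s\end{bmatrix}_q=\frac{[k]_q!}{[s]_q!\,[k-s]_q!}$ is the $q$-binomial coefficient. *)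

theory Defs
  imports "Jordan_Normal_Form.DL_Rank" Complex_Main
begin

inductive_set semigroup_generate :: "('a \<Rightarrow> 'a \<Rightarrow> 'a) \<Rightarrow> 'a set \<Rightarrow> 'a set"
  for opr :: "'a \<Rightarrow> 'a \<Rightarrow> 'a" and A :: "'a set"
  where
    incl: "x \<in> A \<Longrightarrow> x \<in> semigroup_generate opr A"
  | mult: "x \<in> semigroup_generate opr A \<Longrightarrow> y \<in> semigroup_generate opr A \<Longrightarrow>
             opr x y \<in> semigroup_generate opr A"

definition generates_semigroup :: "'a set \<Rightarrow> ('a \<Rightarrow> 'a \<Rightarrow> 'a) \<Rightarrow> 'a set \<Rightarrow> bool" where
  "generates_semigroup S opr A \<longleftrightarrow> A \<subseteq> S \<and> semigroup_generate opr A = S"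

text \<open>Only meaningful for finitely generated semigroups; finiteness of the generating set is
  required explicitly because \<^const>\<open>card\<close> is 0 on infinite sets.\<close>

definition semigroup_rank :: "'a set \<Rightarrow> ('a \<Rightarrow> 'a \<Rightarrow> 'a) \<Rightarrow> nat" where
  "semigroup_rank S opr =
     (LEAST k. \<exists>A. generates_semigroup S opr A \<and> finite A \<and> card A = k)"

definition J_mat :: "nat \<Rightarrow> nat \<Rightarrow> nat \<Rightarrow> 'a :: field mat" where
  "J_mat n m r =
     four_block_mat (1\<^sub>m r) (0\<^sub>m r (m - r)) (0\<^sub>m (n - r) r) (0\<^sub>m (n - r) (m - r))"

text \<open>The semigroup \<open>M\<^sub>m\<^sub>n\<^sup>J\<close> is the set \<^term>\<open>carrier_mat m n\<close> with the operation
  \<open>star_mult m n r\<close>; \<open>J\<close> has the transposed format.\<close>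

definition star_mult ::
  "nat \<Rightarrow> nat \<Rightarrow> nat \<Rightarrow> 'a :: field mat \<Rightarrow> 'a mat \<Rightarrow> 'a mat" where
  "star_mult m n r X Y = X * J_mat n m r * Y"

lemma J_mat_carrier: "r \<le> min m n \<Longrightarrow> J_mat n m r \<in> carrier_mat n m"
  unfolding J_mat_def carrier_mat_def by auto

lemma star_mult_closed:
  assumes "X \<in> carrier_mat m n" "Y \<in> carrier_mat m n"
  shows "star_mult m n r X Y \<in> carrier_mat m n"
  using assms unfolding star_mult_def by auto

lemma star_mult_assoc:
  fixes X Y Z :: "'a :: field mat"
  assumes "r \<le> min m n"
    and X: "X \<in> carrier_mat m n" and Y: "Y \<in> carrier_mat m n" and Z: "Z \<in> carrier_mat m n"
  shows "star_mult m n r (star_mult m n r X Y) Z = star_mult m n r X (star_mult m n r Y Z)"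
proof -
  define J :: "'a mat" where "J = J_mat n m r"
  have J: "J \<in> carrier_mat n m"
    unfolding J_def by (rule J_mat_carrier[OF assms(1)])
  have XJ: "X * J \<in> carrier_mat m m" and YJ: "Y * J \<in> carrier_mat m m"
    using X Y J by auto
  have "X * J * Y * J * Z = X * J * (Y * J) * Z"
    by (simp only: assoc_mult_mat[OF XJ Y J])
  also have "\<dots> = X * J * (Y * J * Z)"
    by (rule assoc_mult_mat[OF XJ YJ Z])
  finally show ?thesis
    unfolding star_mult_def J_def .
qed

text \<open>\<^const>\<open>vec_space.rank\<close> takes the length of the columns as its first argument.\<close>

definition Omega :: "nat \<Rightarrow> nat \<Rightarrow> nat \<Rightarrow> 'a :: field mat set" where
  "Omega m n r = {X \<in> carrier_mat m n. vec_space.rank m X > r}"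

definition q_fact :: "real \<Rightarrow> nat \<Rightarrow> real" where
  "q_fact q s = (\<Prod>i=1..s. \<Sum>j<i. q ^ j)"

definition q_binomial :: "real \<Rightarrow> nat \<Rightarrow> nat \<Rightarrow> real" where
  "q_binomial q k s = q_fact q k / (q_fact q s * q_fact q (k - s))"

end

theory Submission
  imports Defs
begin

text \<open>
  If \<open>A\<close> consists of the first \<open>r\<close> columns of \<open>X\<close> and \<open>B\<close> of the first \<open>r\<close> rows of \<open>Y\<close>, then
  \<open>X \<star> Y = A B\<close>. Hence products have rank at most \<open>r\<close>, and every generating set contains
  \<open>\<Omega>\<close>. Conversely, let \<open>X = P Q\<close> be a full rank factorization of a matrix of rank \<open>s \<le> r\<close>. Pad
  \<open>P\<close> with zero columns and \<open>Q\<close> with zero rows, but place a column outside the column space of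
  \<open>P\<close> (a row outside the row space of \<open>Q\<close>) at position \<open>r\<close>, where \<open>J\<close> annihilates it. This
  writes \<open>X\<close> as a product of two matrices of rank \<open>s + 1\<close>, so downward induction on the rank shows
  that \<open>\<Omega>\<close> generates. For the count, appending a column to an \<open>m \<times> k\<close> matrix of rank \<open>s\<close>
  preserves the rank for \<open>q\<^sup>s\<close> choices of the column and raises it for the other \<open>q\<^sup>m - q\<^sup>s\<close>; the
  resulting recurrence in \<open>k\<close> is solved by the \<open>q\<close>-Pascal rule.
\<close>

section \<open>Rank\<close>

context vec_space
begin

lemma cols_carrier: "A \<in> carrier_mat n k \<Longrightarrow> set (cols A) \<subseteq> carrier_vec n"
  using cols_dim by blast

text \<open>The column space is a vector space in its own right, and a basis of it stays
  independent, with the same span, in the ambient space. The basis property inside the subspace is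
  kept as the last conclusion for the count by coordinates.\<close>

lemma rank_basis_exists:
  assumes A: "A \<in> carrier_mat n k"
  obtains U where "finite U" "U \<subseteq> carrier_vec n" "lin_indpt U" "span U = span (set (cols A))"
    "card U = rank A"
    "vectorspace.basis class_ring (span_vs (set (cols A))) U"
proof -
  let ?W = "span (set (cols A))"
  have S: "set (cols A) \<subseteq> carrier_vec n" using cols_carrier[OF A] .
  have sub: "submodule class_ring ?W V" using span_is_submodule[OF S] .
  interpret W: vectorspace class_ring "vs ?W"
    by (rule subspace_is_vs[OF span_is_subspace]) (use S in simp)
  obtain U where U: "finite U" "W.basis U"
    using W.finite_basis_exists fin_dim_span_cols[OF A] by blast
  have UW: "U \<subseteq> ?W" using U(2) by (simp add: W.basis_def)
  have "lin_indpt U" "span U = ?W"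
    using U(2) span_li_not_depend[OF UW sub] by (simp_all add: W.basis_def)
  moreover have "U \<subseteq> carrier_vec n" using UW S span_is_subset2[OF S] by auto
  moreover have "card U = rank A" using W.dim_basis[OF U] by (simp add: rank_def)
  ultimately show thesis using U that by blast
qed

text \<open>Steinitz exchange.\<close>

lemma lin_indpt_card_le:
  assumes "finite U" "finite S" "S \<subseteq> carrier_vec n" "lin_indpt U" "U \<subseteq> span S"
  shows "card U \<le> card S"
  using replacement[of U S] assms by auto

lemma rank_eqI:
  assumes A: "A \<in> carrier_mat n k"
    and U: "finite U" "U \<subseteq> carrier_vec n" "lin_indpt U" "span U = span (set (cols A))"
  shows "rank A = card U"
proof -
  obtain B where B: "finite B" "B \<subseteq> carrier_vec n" "lin_indpt B" "span B = span (set (cols A))"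
    "card B = rank A" using rank_basis_exists[OF A] by metis
  have "card B \<le> card U" using lin_indpt_card_le B U in_own_span by (metis module_vec_simps(3))
  moreover have "card U \<le> card B" using lin_indpt_card_le B U in_own_span by (metis module_vec_simps(3))
  ultimately show ?thesis using B by simp
qed

text \<open>Only column spaces are compared, by exchange between their bases, so the widths
  \<open>k\<close> and \<open>l\<close> may differ.\<close>

lemma rank_mono:
  assumes A: "A \<in> carrier_mat n k" and B: "B \<in> carrier_mat n l"
    and sub: "span (set (cols A)) \<subseteq> span (set (cols B))"
  shows "rank A \<le> rank B"
proof -
  obtain U where U: "finite U" "U \<subseteq> carrier_vec n" "lin_indpt U" "span U = span (set (cols A))"
    "card U = rank A" using rank_basis_exists[OF A] by metis
  obtain W where W: "finite W" "W \<subseteq> carrier_vec n" "lin_indpt W" "span W = span (set (cols B))"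
    "card W = rank B" using rank_basis_exists[OF B] by metis
  have "U \<subseteq> span W" using U W sub in_own_span by (metis module_vec_simps(3) subset_trans)
  thus ?thesis using lin_indpt_card_le[of U W] U W by simp
qed

lemma mult_mat_vec_in_span_cols:
  assumes "A \<in> carrier_mat n k" "x \<in> carrier_vec k"
  shows "A *\<^sub>v x \<in> span (set (cols A))"
  using assms col_space_eq[OF assms(1)] by (auto simp: col_space_def)

lemma in_span_colsE:
  assumes "A \<in> carrier_mat n k" "v \<in> span (set (cols A))"
  obtains x where "x \<in> carrier_vec k" "v = A *\<^sub>v x"
  using assms col_space_eq[OF assms(1)] by (auto simp: col_space_def)

lemma rank_mult_le_left:
  assumes A: "A \<in> carrier_mat n k" and B: "B \<in> carrier_mat k l"
  shows "rank (A * B) \<le> rank A"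
proof (rule rank_mono)
  show "span (set (cols (A * B))) \<subseteq> span (set (cols A))"
  proof (rule span_subsetI)
    show "set (cols (A * B)) \<subseteq> span (set (cols A))"
    proof
      fix v assume "v \<in> set (cols (A * B))"
      then obtain j where j: "j < l" "v = col (A * B) j"
        using B by (auto simp: cols_def)
      hence "v = A *\<^sub>v col B j" using A B by (intro eq_vecI) auto
      thus "v \<in> span (set (cols A))" using A B j by (auto intro!: mult_mat_vec_in_span_cols)
    qed
  qed (use cols_carrier A in auto)
qed (use A B in auto)

text \<open>The columns of \<open>P\<close> form a basis of the column space of \<open>A\<close>,
  and each column of \<open>Q\<close> holds the coordinates of the corresponding column of
  \<open>A\<close>.\<close>

lemma rank_factorization:
  assumes A: "A \<in> carrier_mat n k"
  obtains P Q where "P \<in> carrier_mat n (rank A)" "Q \<in> carrier_mat (rank A) k" "A = P * Q"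
proof -
  obtain U where U: "finite U" "U \<subseteq> carrier_vec n" "lin_indpt U" "span U = span (set (cols A))"
    "card U = rank A" using rank_basis_exists[OF A] by metis
  obtain us where us: "set us = U" "distinct us" using U(1) finite_distinct_list by blast
  define P where "P = mat_of_cols n us"
  have P: "P \<in> carrier_mat n (rank A)" using us U(5) distinct_card[of us] by (auto simp: P_def)
  have cP: "set (cols P) = U" using us U by (simp add: P_def cols_mat_of_cols)
  have "\<exists>x. x \<in> carrier_vec (rank A) \<and> col A j = P *\<^sub>v x" if "j < k" for j
  proof -
    have "col A j \<in> set (cols A)" using that A by (auto simp: cols_def)
    hence "col A j \<in> span (set (cols P))" using U(4) cP span_mem cols_carrier[OF A] by (metis module_vec_simps(3))
    thus ?thesis using in_span_colsE[OF P] by metis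
  qed
  then obtain x where x: "\<And>j. j < k \<Longrightarrow> x j \<in> carrier_vec (rank A) \<and> col A j = P *\<^sub>v x j"
    by metis
  define Q where "Q = mat (rank A) k (\<lambda>(i,j). x j $ i)"
  have Q: "Q \<in> carrier_mat (rank A) k" by (simp add: Q_def)
  have "A = P * Q"
  proof (rule mat_col_eqI)
    fix j assume "j < dim_col (P * Q)"
    hence j: "j < k" using Q by simp
    have "col Q j = x j" using x[OF j] j by (intro eq_vecI) (auto simp: Q_def)
    thus "col A j = col (P * Q) j" using x[OF j] P Q j by (auto simp: col_mult2[OF P Q])
  qed (use A P Q in auto)
  thus thesis using that P Q by blast
qed

text \<open>A basis of the column space of \<open>A\<close> still serves if \<open>v\<close> lies in
  that space; otherwise adjoining \<open>v\<close> to it gives a basis of the enlarged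
  space.\<close>

lemma rank_append_col:
  assumes A: "A \<in> carrier_mat n k" and v: "v \<in> carrier_vec n"
  shows "rank (mat_of_cols n (cols A @ [v])) =
    (if v \<in> span (set (cols A)) then rank A else Suc (rank A))"
proof -
  let ?B = "mat_of_cols n (cols A @ [v])"
  have cA: "set (cols A) \<subseteq> carrier_vec n" using cols_carrier[OF A] .
  have B: "?B \<in> carrier_mat n (Suc k)" using A by auto
  have cB: "set (cols ?B) = set (cols A) \<union> {v}"
    using cA v by (subst cols_mat_of_cols) auto
  obtain U where U: "finite U" "U \<subseteq> carrier_vec n" "lin_indpt U" "span U = span (set (cols A))"
    "card U = rank A" using rank_basis_exists[OF A] by metis
  show ?thesis
  proof (cases "v \<in> span (set (cols A))")
    case True
    have "span (set (cols A)) = span (set (cols ?B))"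
      unfolding cB using already_in_span[OF _ True] cA by simp
    hence "rank ?B = card U" using U by (intro rank_eqI[OF B]) auto
    thus ?thesis using True U by simp
  next
    case False
    have vU: "v \<notin> U" using False U in_own_span[of U] by auto
    have li: "lin_indpt (U \<union> {v})" using lin_dep_iff_in_span[of U v] U v vU False by auto
    have "span (U \<union> {v}) = span (set (cols A) \<union> {v})"
    proof
      show "span (U \<union> {v}) \<subseteq> span (set (cols A) \<union> {v})"
      proof (rule span_subsetI)
        have "U \<subseteq> span (set (cols A) \<union> {v})"
          using U(2,4) in_own_span[of U] span_is_monotone[of "set (cols A)" "set (cols A) \<union> {v}"]
          by (simp add: subset_trans[of U "span (set (cols A))"] subset_insertI)
        thus "U \<union> {v} \<subseteq> span (set (cols A) \<union> {v})"
          using in_own_span[of "set (cols A) \<union> {v}"] cA v by auto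
      qed (use cA v in auto)
      show "span (set (cols A) \<union> {v}) \<subseteq> span (U \<union> {v})"
      proof (rule span_subsetI)
        have "set (cols A) \<subseteq> span (U \<union> {v})"
          using U(4) in_own_span[of "set (cols A)"] cA span_is_monotone[of U "U \<union> {v}"]
          by (simp add: subset_trans[of "set (cols A)" "span (set (cols A))"] subset_insertI)
        thus "set (cols A) \<union> {v} \<subseteq> span (U \<union> {v})"
          using in_own_span[of "U \<union> {v}"] U v by auto
      qed (use U v in auto)
    qed
    hence "rank ?B = card (U \<union> {v})" using U v li cB by (intro rank_eqI[OF B]) auto
    thus ?thesis using False U vU by simp
  qed
qed

lemma rank_one_mat: "rank (1\<^sub>m n) = n"
  using det_rank_iff[of "1\<^sub>m n"] by simp

lemma card_span_cols:
  assumes A: "A \<in> carrier_mat n k" and fin: "finite (UNIV :: 'a set)"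
  shows "card (span (set (cols A))) = card (UNIV :: 'a set) ^ rank A"
    "finite (span (set (cols A)))"
proof -
  let ?W = "span (set (cols A))"
  have S: "set (cols A) \<subseteq> carrier_vec n" using cols_carrier[OF A] .
  interpret W: vectorspace class_ring "vs ?W"
    by (rule subspace_is_vs[OF span_is_subspace]) (use S in simp)
  obtain U where U: "finite U" "U \<subseteq> carrier_vec n" "lin_indpt U" "span U = ?W"
    "card U = rank A" "W.basis U" using rank_basis_exists[OF A] by metis
  \<comment> \<open>Coordinates with respect to \<open>U\<close> identify the column space with the
    functions from \<open>U\<close> to the field. Extensionality fixes the values off
    \<open>U\<close>, which makes the coefficient function unique.\<close>
  have crit: "\<forall>v. v \<in> ?W \<longrightarrow> (\<exists>!a. a \<in> U \<rightarrow>\<^sub>E UNIV \<and> W.lincomb a U = v)"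
    using W.basis_criterion[of U] U by (simp add: W.basis_def)
  have closed: "W.lincomb a U \<in> ?W" for a :: "'a vec \<Rightarrow> 'a"
    using W.lincomb_closed[of U a] U(6) by (auto simp: W.basis_def)
  have "bij_betw (\<lambda>a. W.lincomb a U) (U \<rightarrow>\<^sub>E UNIV) ?W"
    unfolding bij_betw_def inj_on_def using crit closed by (auto simp: image_iff) metis+
  moreover have "card (U \<rightarrow>\<^sub>E (UNIV :: 'a set)) = card (UNIV :: 'a set) ^ rank A"
    using U by (simp add: card_PiE)
  moreover have "finite (U \<rightarrow>\<^sub>E (UNIV :: 'a set))" using U fin by (simp add: finite_PiE)
  ultimately show "card ?W = card (UNIV :: 'a set) ^ rank A" "finite ?W"
    using bij_betw_same_card bij_betw_finite by metis+
qed

lemma card_carrier_vec: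
  assumes "finite (UNIV :: 'a set)"
  shows "card (carrier_vec n :: 'a vec set) = card (UNIV :: 'a set) ^ n"
    "finite (carrier_vec n :: 'a vec set)"
proof -
  \<comment> \<open>The whole space is the column space of the identity matrix, so its size is an
    instance of \<open>card_span_cols\<close>.\<close>
  have "cols (1\<^sub>m n :: 'a mat) = unit_vecs n"
    by (auto simp: cols_def unit_vecs_def)
  hence "span (set (cols (1\<^sub>m n))) = carrier_vec n" by (simp add: span_unit_vecs_is_carrier)
  thus "card (carrier_vec n :: 'a vec set) = card (UNIV :: 'a set) ^ n"
    "finite (carrier_vec n :: 'a vec set)"
    using card_span_cols[of "1\<^sub>m n" n] assms rank_one_mat by auto
qed

end

section \<open>Row rank equals column rank\<close>

lemma rank_transpose_le:
  fixes A :: "'a :: field mat"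
  assumes A: "A \<in> carrier_mat m n"
  shows "vec_space.rank n A\<^sup>T \<le> vec_space.rank m A"
proof -
  obtain P Q where PQ: "P \<in> carrier_mat m (vec_space.rank m A)" 
      "Q \<in> carrier_mat (vec_space.rank m A) n" "A = P * Q"
    using vec_space.rank_factorization[OF A] by metis
  \<comment> \<open>The inner dimension of the factorization is the rank of \<open>A\<close>, so the
    transpose of \<open>Q\<close> has only that many columns.\<close>
  have "A\<^sup>T = Q\<^sup>T * P\<^sup>T" using transpose_mult[OF PQ(1,2)] PQ(3) by simp
  moreover have "vec_space.rank n (Q\<^sup>T * P\<^sup>T) \<le> vec_space.rank n Q\<^sup>T"
    using PQ by (intro vec_space.rank_mult_le_left) auto
  moreover have "vec_space.rank n Q\<^sup>T \<le> vec_space.rank m A"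
    using PQ by (intro vec_space.rank_le_nc) auto
  ultimately show ?thesis by simp
qed

lemma rank_transpose:
  fixes A :: "'a :: field mat"
  assumes A: "A \<in> carrier_mat m n"
  shows "vec_space.rank n A\<^sup>T = vec_space.rank m A"
  using rank_transpose_le[OF A] rank_transpose_le[of "A\<^sup>T" n m] A by auto

lemma rank_mult_le_right:
  fixes A B :: "'a :: field mat"
  assumes A: "A \<in> carrier_mat m k" and B: "B \<in> carrier_mat k n"
  shows "vec_space.rank m (A * B) \<le> vec_space.rank k B"
proof -
  have "vec_space.rank m (A * B) = vec_space.rank n (B\<^sup>T * A\<^sup>T)"
    using A B rank_transpose[of "A * B" m n] by (simp add: transpose_mult[OF A B])
  also have "\<dots> \<le> vec_space.rank n B\<^sup>T"
    using A B by (intro vec_space.rank_mult_le_left) auto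
  finally show ?thesis using rank_transpose[OF B] by simp
qed

section \<open>Counting matrices of given rank\<close>

definition q_int :: "real \<Rightarrow> nat \<Rightarrow> real" where
  "q_int q k = (\<Sum>j<k. q ^ j)"

lemma q_fact_0 [simp]: "q_fact q 0 = 1"
  by (simp add: q_fact_def)

lemma q_fact_Suc: "q_fact q (Suc s) = q_fact q s * q_int q (Suc s)"
  by (simp add: q_fact_def q_int_def)

lemma q_int_pos: "q \<ge> 0 \<Longrightarrow> k > 0 \<Longrightarrow> q_int q k > 0"
  unfolding q_int_def by (rule sum_pos2[of _ 0]) auto

lemma q_fact_pos: "q \<ge> 0 \<Longrightarrow> q_fact q k > 0"
  by (induction k) (auto simp: q_fact_Suc q_int_pos)

lemma q_int_add: "q_int q (a + b) = q_int q a + q ^ a * q_int q b"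
  by (induction b) (simp_all add: q_int_def power_add algebra_simps)

lemma q_binomial_0 [simp]: "q \<ge> 0 \<Longrightarrow> q_binomial q n 0 = 1"
  using q_fact_pos[of q n] by (simp add: q_binomial_def)

lemma q_binomial_self [simp]: "q \<ge> 0 \<Longrightarrow> q_binomial q n n = 1"
  using q_fact_pos[of q n] by (simp add: q_binomial_def)

text \<open>The q-Pascal rule, from splitting \<open>q_int q (Suc n)\<close> after its first
  \<open>Suc s\<close> terms. The bound on \<open>s\<close> is strict because of truncated
  subtraction: \<open>q_binomial q n (Suc n)\<close> is not 0.\<close>

lemma q_binomial_Suc_Suc:
  assumes q: "q \<ge> 0" and "s < n"
  shows "q_binomial q (Suc n) (Suc s) = q ^ Suc s * q_binomial q n (Suc s) + q_binomial q n s"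
proof -
  \<comment> \<open>Writing \<open>n\<close> as a sum turns the truncated differences into
    \<open>d\<close> and \<open>Suc d\<close>.\<close>
  obtain d where n: "n = s + Suc d" using \<open>s < n\<close> less_iff_Suc_add by auto
  have e: "q_int q (Suc n) = q_int q (Suc s) + q ^ Suc s * q_int q (Suc d)"
    using q_int_add[of q "Suc s" "Suc d"] by (simp add: n)
  have nz: "q_fact q s \<noteq> 0" "q_fact q d \<noteq> 0" "q_int q (Suc s) \<noteq> 0" "q_int q (Suc d) \<noteq> 0"
    using q_fact_pos[OF q] q_int_pos[OF q] by (metis less_irrefl zero_less_Suc)+
  have b1: "q_binomial q (Suc n) (Suc s) = q_fact q n * q_int q (Suc n) /
    (q_fact q s * q_int q (Suc s) * (q_fact q d * q_int q (Suc d)))"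
    by (simp add: q_binomial_def n q_fact_Suc)
  have b2: "q_binomial q n (Suc s) = q_fact q n / (q_fact q s * q_int q (Suc s) * q_fact q d)"
    by (simp add: q_binomial_def n q_fact_Suc)
  have b3: "q_binomial q n s = q_fact q n / (q_fact q s * (q_fact q d * q_int q (Suc d)))"
    by (simp add: q_binomial_def n q_fact_Suc)
  show ?thesis unfolding b1 b2 b3 e using nz
    by (simp add: divide_simps) (simp add: algebra_simps)
qed

text \<open>Each factor equals \<open>q ^ i * (q - 1) * q_int q (m - i)\<close>. The powers of
  \<open>q\<close> collect to the exponent \<open>s choose 2\<close>, and the q-integers to
  \<open>q_fact q m / q_fact q (m - s)\<close>. For a field of size \<open>q\<close> the product
  counts the independent \<open>s\<close>-tuples of vectors of length \<open>m\<close>.\<close>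

lemma prod_diff_powers_eq:
  assumes q: "q \<ge> 0" and "s \<le> m"
  shows "(\<Prod>i<s. q ^ m - q ^ i) = q_binomial q m s * q ^ (s choose 2) * (q - 1) ^ s * q_fact q s"
  using \<open>s \<le> m\<close>
proof (induction s)
  case 0
  thus ?case using q by (simp add: numeral_2_eq_2)
next
  case (Suc s)
  obtain d where m: "m = s + Suc d" using Suc.prems less_iff_Suc_add[of s m] by auto
  have "q ^ m - q ^ s = q ^ s * (q ^ Suc d - 1)"
    by (simp add: m power_add algebra_simps)
  also have "\<dots> = q ^ s * (q - 1) * q_int q (Suc d)"
    by (simp only: q_int_def power_diff_1_eq mult.assoc)
  finally have last: "q ^ m - q ^ s = q ^ s * (q - 1) * q_int q (Suc d)" .
  have d: "m - s = Suc d" "m - Suc s = d" by (simp_all add: m)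
  have nz: "q_fact q k \<noteq> 0" "q_int q (Suc k) \<noteq> 0" for k
    using q_fact_pos[OF q, of k] q_int_pos[OF q, of "Suc k"] by simp_all
  have "(\<Prod>i<s. q ^ m - q ^ i) =
    q_fact q m / (q_fact q d * q_int q (Suc d)) * q ^ (s choose 2) * (q - 1) ^ s"
    using Suc nz by (simp add: q_binomial_def d q_fact_Suc)
  hence "(\<Prod>i<Suc s. q ^ m - q ^ i) =
    q_fact q m / q_fact q d * (q ^ s * q ^ (s choose 2)) * (q - 1) ^ Suc s"
    using nz[of d] by (simp add: last)
  moreover have "Suc s choose 2 = s + (s choose 2)" by (simp add: numeral_2_eq_2)
  ultimately show ?case using nz[of "Suc s"] by (simp add: q_binomial_def d power_add)
qed

section \<open>Recurrence in the number of columns\<close>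

lemma finite_carrier_mat:
  assumes "finite (UNIV :: 'a set)"
  shows "finite (carrier_mat m n :: 'a mat set)"
proof (rule finite_surj)
  show "finite ({..<m} \<times> {..<n} \<rightarrow>\<^sub>E (UNIV :: 'a set))"
    using assms by (intro finite_PiE) auto
  show "carrier_mat m n \<subseteq> mat m n ` ({..<m} \<times> {..<n} \<rightarrow>\<^sub>E (UNIV :: 'a set))"
  proof
    fix A :: "'a mat" assume "A \<in> carrier_mat m n"
    hence "A = mat m n (restrict (\<lambda>ij. A $$ ij) ({..<m} \<times> {..<n}))"
      by (intro eq_matI) auto
    thus "A \<in> mat m n ` ({..<m} \<times> {..<n} \<rightarrow>\<^sub>E (UNIV :: 'a set))"
      by (rule image_eqI[where f = "mat m n"]) simp
  qed
qed

context vec_space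
begin

lemma card_span_compl:
  assumes A: "A \<in> carrier_mat n k" and fin: "finite (UNIV :: 'a set)"
  shows "real (card (carrier_vec n - span (set (cols A)))) =
    real (card (UNIV :: 'a set)) ^ n - real (card (UNIV :: 'a set)) ^ rank A"
proof -
  have sub: "span (set (cols A)) \<subseteq> carrier_vec n"
    using span_is_subset2 cols_carrier[OF A] by simp
  have "card (span (set (cols A))) \<le> card (carrier_vec n :: 'a vec set)"
    using card_mono[OF card_carrier_vec(2)[OF fin] sub] .
  thus ?thesis
    using card_Diff_subset[OF card_span_cols(2)[OF A fin] sub] 
      card_span_cols(1)[OF A fin] card_carrier_vec(1)[OF fin]
    by (simp add: of_nat_diff)
qed

lemma bij_betw_append_col:
  "bij_betw (\<lambda>(A, v). mat_of_cols n (cols A @ [v]))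
     ((carrier_mat n k :: 'a mat set) \<times> carrier_vec n) (carrier_mat n (Suc k))"
proof (rule bij_betw_byWitness
    [where f' = "\<lambda>B. (mat_of_cols n (butlast (cols B)), last (cols B))"])
  show "\<forall>x\<in>(carrier_mat n k :: 'a mat set) \<times> carrier_vec n.
     (\<lambda>B. (mat_of_cols n (butlast (cols B)), last (cols B)))
       ((\<lambda>(A, v). mat_of_cols n (cols A @ [v])) x) = x"
  proof
    fix x :: "'a mat \<times> 'a vec" assume "x \<in> carrier_mat n k \<times> carrier_vec n"
    then obtain A v where x: "x = (A, v)" and A: "A \<in> carrier_mat n k" and v: "v \<in> carrier_vec n"
      by blast
    have "cols (mat_of_cols n (cols A @ [v])) = cols A @ [v]"
      using cols_carrier[OF A] v by (intro cols_mat_of_cols) auto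
    moreover have "mat_of_cols n (cols A) = A" using A mat_of_cols_cols by auto
    ultimately show "(\<lambda>B. (mat_of_cols n (butlast (cols B)), last (cols B)))
       ((\<lambda>(A, v). mat_of_cols n (cols A @ [v])) x) = x" by (simp add: x)
  qed
  show "\<forall>B\<in>(carrier_mat n (Suc k) :: 'a mat set). (\<lambda>(A, v). mat_of_cols n (cols A @ [v]))
    (mat_of_cols n (butlast (cols B)), last (cols B)) = B"
  proof
    fix B :: "'a mat" assume B: "B \<in> carrier_mat n (Suc k)"
    have "set (butlast (cols B)) \<subseteq> carrier_vec n"
      using cols_carrier[OF B] by (auto dest: in_set_butlastD)
    hence "cols (mat_of_cols n (butlast (cols B))) = butlast (cols B)" by (rule cols_mat_of_cols)
    moreover have "cols B \<noteq> []" using B by (auto simp flip: length_0_conv)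
    ultimately show "(\<lambda>(A, v). mat_of_cols n (cols A @ [v]))
      (mat_of_cols n (butlast (cols B)), last (cols B)) = B"
      using B mat_of_cols_cols[of B] by simp
  qed
  show "(\<lambda>(A, v). mat_of_cols n (cols A @ [v])) ` ((carrier_mat n k :: 'a mat set) \<times> carrier_vec n)
    \<subseteq> carrier_mat n (Suc k)"
    by auto
  show "(\<lambda>B. (mat_of_cols n (butlast (cols B)), last (cols B))) ` (carrier_mat n (Suc k) :: 'a mat set)
    \<subseteq> carrier_mat n k \<times> carrier_vec n"
  proof (rule image_subsetI)
    fix B :: "'a mat" assume B: "B \<in> carrier_mat n (Suc k)"
    hence "cols B \<noteq> []" by (auto simp flip: length_0_conv)
    hence "last (cols B) \<in> carrier_vec n" using cols_carrier[OF B] last_in_set by blast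
    moreover have "mat_of_cols n (butlast (cols B)) \<in> carrier_mat n k" using B by (auto simp: mat_of_cols_def)
    ultimately show "(mat_of_cols n (butlast (cols B)), last (cols B))
      \<in> carrier_mat n k \<times> carrier_vec n" by simp
  qed
qed

text \<open>Split off the last column \<open>v\<close>. Rank \<open>s\<close> arises from a
  remaining matrix of rank \<open>s\<close> with \<open>v\<close> in its column space, or from one
  of rank \<open>s - 1\<close> with \<open>v\<close> outside it. Here \<open>n\<close> is the number
  of rows.\<close>

lemma card_rank_Suc:
  assumes fin: "finite (UNIV :: 'a set)"
  defines "q \<equiv> real (card (UNIV :: 'a set))"
  shows "real (card {A \<in> carrier_mat n (Suc k). rank A = s}) =
    q ^ s * real (card {A \<in> carrier_mat n k. rank A = s}) +
    (if s = 0 then 0 else (q ^ n - q ^ (s - 1)) * real (card {A \<in> carrier_mat n k. rank A = s - 1}))"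
proof -
  let ?f = "\<lambda>(A, v). mat_of_cols n (cols A @ [v])"
  let ?R = "\<lambda>s. {A \<in> carrier_mat n k. rank A = s}"
  let ?S = "SIGMA A:?R s. span (set (cols A))"
  \<comment> \<open>The guard matters at \<open>s = 0\<close>, where \<open>s - 1\<close> truncates
    to 0 and would admit matrices whose rank becomes 1.\<close>
  let ?T = "SIGMA A:(if s = 0 then {} else ?R (s - 1)). carrier_vec n - span (set (cols A))"
  have sub: "span (set (cols A)) \<subseteq> carrier_vec n" if "A \<in> carrier_mat n k" for A
    using span_is_subset2 cols_carrier[OF that] by simp
  have dom: "{x \<in> carrier_mat n k \<times> carrier_vec n. rank (?f x) = s} = ?S \<union> ?T"
  proof (rule Set.set_eqI)
    fix x :: "'a mat \<times> 'a vec"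
    obtain A v where x: "x = (A, v)" by fastforce
    have "A \<in> carrier_mat n k \<Longrightarrow> v \<in> span (set (cols A)) \<Longrightarrow> v \<in> carrier_vec n"
      using sub by blast
    thus "x \<in> {x \<in> carrier_mat n k \<times> carrier_vec n. rank (?f x) = s} \<longleftrightarrow> x \<in> ?S \<union> ?T"
      unfolding x by (cases "A \<in> carrier_mat n k \<and> v \<in> carrier_vec n";
        cases "v \<in> span (set (cols A))") (auto simp: rank_append_col)
  qed
  have "bij_betw ?f {x \<in> carrier_mat n k \<times> carrier_vec n. rank (?f x) = s}
     {A \<in> carrier_mat n (Suc k). rank A = s}"
    by (rule bij_betw_Collect[OF bij_betw_append_col]) simp
  from bij_betw_same_card[OF this, unfolded dom]
  have "card {A \<in> carrier_mat n (Suc k). rank A = s} = card (?S \<union> ?T)" by (rule sym)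
  moreover have "card (?S \<union> ?T) = card ?S + card ?T"
  proof (rule card_Un_disjoint)
    have "finite ((carrier_mat n k :: 'a mat set) \<times> (carrier_vec n :: 'a vec set))"
      by (rule finite_cartesian_product[OF finite_carrier_mat[OF fin] card_carrier_vec(2)[OF fin]])
    moreover have "?S \<subseteq> carrier_mat n k \<times> carrier_vec n"
      by (rule Sigma_mono) (simp_all add: sub Collect_subset)
    moreover have "?T \<subseteq> carrier_mat n k \<times> carrier_vec n"
      by (rule Sigma_mono) (simp_all add: Collect_subset)
    ultimately show "finite ?S" "finite ?T" by (blast intro: finite_subset)+
    show "?S \<inter> ?T = {}" by (simp add: disjoint_iff)
  qed
  moreover have "real (card ?S + card ?T) = q ^ s * real (card (?R s)) +
    (if s = 0 then 0 else (q ^ n - q ^ (s - 1)) * real (card (?R (s - 1))))"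
  proof -
    have finR: "finite (?R s)" for s
      using finite_carrier_mat[OF fin, of n k] by (rule rev_finite_subset) simp
    have "card ?S = (\<Sum>A\<in>?R s. card (span (set (cols A))))"
      using finR card_span_cols(2)[OF _ fin, of _ k] by (intro card_SigmaI) simp_all
    also have "\<dots> = (\<Sum>A\<in>?R s. card (UNIV :: 'a set) ^ s)"
      using card_span_cols(1)[OF _ fin, of _ k] by (intro sum.cong) simp_all
    finally have S: "real (card ?S) = q ^ s * real (card (?R s))"
      by (simp add: q_def)
    have "real (card ?T) = (q ^ n - q ^ (s - 1)) * real (card (?R (s - 1)))" if "s \<noteq> 0"
    proof -
      have "card ?T = (\<Sum>A\<in>?R (s - 1). card (carrier_vec n - span (set (cols A))))"
        using finR card_carrier_vec(2)[OF fin] that by (subst card_SigmaI) simp_all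
      hence "real (card ?T) = (\<Sum>A\<in>?R (s - 1). real (card (carrier_vec n - span (set (cols A)))))"
        by simp
      also have "\<dots> = (\<Sum>A\<in>?R (s - 1). q ^ n - q ^ (s - 1))"
        using card_span_compl[OF _ fin, of _ k] by (intro sum.cong) (simp_all add: q_def)
      finally show ?thesis by simp
    qed
    thus ?thesis using S by simp
  qed
  ultimately show ?thesis by (simp only:)
qed

text \<open>The binomial corresponds to the choice of an \<open>s\<close>-dimensional row space in
  dimension \<open>k\<close>, the product to the \<open>n x s\<close> matrices of full column rank.
  The proof verifies the closed form against the recurrence.\<close>

lemma card_rank_eq:
  assumes fin: "finite (UNIV :: 'a set)" and "s \<le> k"
  defines "q \<equiv> real (card (UNIV :: 'a set))"
  shows "real (card {A \<in> carrier_mat n k. rank A = s}) =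
    (\<Prod>i<s. q ^ n - q ^ i) * q_binomial q k s"
  using \<open>s \<le> k\<close>
proof (induction k arbitrary: s)
  case 0
  \<comment> \<open>With no columns there is exactly one matrix, of rank 0.\<close>
  have "{A \<in> carrier_mat n 0. rank A = 0} = {0\<^sub>m n 0}"
    using rank_le_nc by (auto simp: rank_0I)
  thus ?case using 0 by (simp add: q_def)
next
  case (Suc k)
  have q: "q \<ge> 0" by (simp add: q_def)
  note rec = card_rank_Suc[OF fin, of k s, folded q_def]
  show ?case
  proof (cases s)
    case 0
    thus ?thesis using rec Suc.IH[of 0] q by simp
  next
    case (Suc t)
    show ?thesis
    \<comment> \<open>At \<open>s = Suc k\<close> the q-Pascal rule does not apply. No matrix with
      \<open>k\<close> columns has rank \<open>Suc k\<close>, so only the rank-raising term of the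
      recurrence survives.\<close>
    proof (cases "t = k")
      case True
      have "rank A \<noteq> Suc k" if "A \<in> carrier_mat n k" for A
        using rank_le_nc[OF that] by simp
      hence "card {A \<in> carrier_mat n k. rank A = Suc k} = 0" by (metis (mono_tags, lifting) Collect_empty_eq card.empty)
      thus ?thesis using rec Suc.IH[of k] q True Suc by simp
    next
      case False
      hence "t < k" using Suc Suc.prems by simp
      thus ?thesis using rec Suc.IH[of t] Suc.IH[of "Suc t"] q q_binomial_Suc_Suc[of q t k] Suc
        by (simp add: algebra_simps)
    qed
  qed
qed

end

section \<open>The sandwich semigroup\<close>

text \<open>Right multiplication by \<open>J\<close> keeps the first \<open>r\<close> columns of
  \<open>X\<close> and clears the others. The inner dimension \<open>r\<close> bounds the rank of
  products and leaves the columns of \<open>X\<close> and rows of \<open>Y\<close> from position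
  \<open>r\<close> on without influence.\<close>

lemma star_mult_eq:
  fixes X Y :: "'a :: field mat"
  assumes r: "r \<le> min m n" and X: "X \<in> carrier_mat m n" and Y: "Y \<in> carrier_mat m n"
  shows "star_mult m n r X Y = mat m r (\<lambda>ij. X $$ ij) * mat r n (\<lambda>ij. Y $$ ij)"
proof -
  let ?J = "J_mat n m r :: 'a mat"
  have J: "?J \<in> carrier_mat n m" using J_mat_carrier[OF r] .
  have Jidx: "?J $$ (i, j) = (if i = j \<and> i < r then 1 else 0)" if "i < n" "j < m" for i j
    using that r by (auto simp: J_mat_def)
  have XJ: "(X * ?J) $$ (i, j) = (if j < r then X $$ (i, j) else 0)" if "i < m" "j < m" for i j
  proof -
    have "(X * ?J) $$ (i, j) = (\<Sum>k<n. X $$ (i, k) * ?J $$ (k, j))"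
      using X J that by (simp add: scalar_prod_def lessThan_atLeast0)
    also have "\<dots> = (\<Sum>k<n. if k = j then (if j < r then X $$ (i, j) else 0) else 0)"
      using that by (intro sum.cong) (auto simp: Jidx)
    also have "\<dots> = (if j < r then X $$ (i, j) else 0)"
      \<comment> \<open>For \<open>j < r\<close> the bound \<open>r <= n\<close> ensures that
        \<open>k = j\<close> occurs in the sum.\<close>
      using r by (simp add: sum.delta)
    finally show ?thesis .
  qed
  show ?thesis
  proof (rule eq_matI)
    fix i j assume "i < dim_row (mat m r (\<lambda>ij. X $$ ij) * mat r n (\<lambda>ij. Y $$ ij))"
      "j < dim_col (mat m r (\<lambda>ij. X $$ ij) * mat r n (\<lambda>ij. Y $$ ij))"
    hence ij: "i < m" "j < n" by auto
    have "star_mult m n r X Y $$ (i, j) = (\<Sum>k<m. (X * ?J) $$ (i, k) * Y $$ (k, j))"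
      using X Y J ij by (simp add: star_mult_def scalar_prod_def lessThan_atLeast0 del: assoc_mult_mat)
    also have "\<dots> = (\<Sum>k<r. X $$ (i, k) * Y $$ (k, j))"
      using r ij by (intro sum.mono_neutral_cong_right) (auto simp: XJ)
    also have "\<dots> = (mat m r (\<lambda>ij. X $$ ij) * mat r n (\<lambda>ij. Y $$ ij)) $$ (i, j)"
      using ij by (simp add: scalar_prod_def lessThan_atLeast0)
    finally show "star_mult m n r X Y $$ (i, j) =
      (mat m r (\<lambda>ij. X $$ ij) * mat r n (\<lambda>ij. Y $$ ij)) $$ (i, j)" .
  qed (use X Y in \<open>auto simp: star_mult_def\<close>)
qed

lemma rank_star_mult_le:
  fixes X Y :: "'a :: field mat"
  assumes "r \<le> min m n" "X \<in> carrier_mat m n" "Y \<in> carrier_mat m n"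
  shows "vec_space.rank m (star_mult m n r X Y) \<le> r"
proof -
  have "vec_space.rank m (star_mult m n r X Y) \<le> vec_space.rank m (mat m r (\<lambda>ij. X $$ ij))"
    unfolding star_mult_eq[OF assms] by (rule vec_space.rank_mult_le_left) auto
  also have "\<dots> \<le> r" by (rule vec_space.rank_le_nc) simp
  finally show ?thesis .
qed

section \<open>Writing a matrix of low rank as a product of matrices of higher rank\<close>

lemma (in vec_space) not_in_span_colsE:
  assumes P: "P \<in> carrier_mat n s" and "s < n"
  obtains c where "c \<in> carrier_vec n" "c \<notin> span (set (cols P))"
proof -
  \<comment> \<open>Otherwise the identity, of rank \<open>n\<close>, would have rank at most that
    of \<open>P\<close>, hence at most \<open>s < n\<close>.\<close>
  have "\<not> carrier_vec n \<subseteq> span (set (cols P))"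
  proof
    assume "carrier_vec n \<subseteq> span (set (cols P))"
    moreover have "span (set (cols (1\<^sub>m n))) \<subseteq> carrier_vec n"
      using span_is_subset2[OF cols_carrier[of "1\<^sub>m n" n]] by simp
    ultimately have "rank (1\<^sub>m n) \<le> rank P" by (intro rank_mono[OF _ P]) auto
    thus False using rank_le_nc[OF P] \<open>s < n\<close> rank_one_mat by simp
  qed
  thus thesis using that by blast
qed

text \<open>The extra column sits at position \<open>r\<close>, where the sandwich matrix \<open>J\<close> annihilates it.\<close>

lemma (in vec_space) pad_with_independent_col:
  assumes P: "P \<in> carrier_mat n s" "rank P = s" and s: "s < n" "s \<le> r" "r < k"
  obtains A where "A \<in> carrier_mat n k" "rank A > s"
    "\<And>i j. i < n \<Longrightarrow> j < r \<Longrightarrow> A $$ (i, j) = (if j < s then P $$ (i, j) else 0)"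
proof -
  obtain c where c: "c \<in> carrier_vec n" "c \<notin> span (set (cols P))"
    using not_in_span_colsE[OF P(1) s(1)] .
  let ?P = "mat_of_cols n (cols P @ [c])"
  \<comment> \<open>Since \<open>s <= r\<close>, column \<open>r\<close> is free for
    \<open>c\<close>; it exists because \<open>r < k\<close>. Every other column from
    \<open>s\<close> on is zero.\<close>
  define A where "A = mat n k (\<lambda>(i, j). if j < s then P $$ (i, j) else if j = r then c $ i else 0)"
  have A: "A \<in> carrier_mat n k" by (simp add: A_def)
  have "set (cols ?P) = set (cols P) \<union> {c}"
    using cols_carrier[OF P(1)] c by (subst cols_mat_of_cols) auto
  also have "\<dots> \<subseteq> set (cols A)"
  proof -
    have "col P j = col A j" if "j < s" for j
      using that P s by (intro eq_vecI) (auto simp: A_def)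
    hence "set (cols P) \<subseteq> set (cols A)" using P(1) A s by (auto simp: cols_def)
    moreover have "c = col A r" using c s by (intro eq_vecI) (auto simp: A_def)
    hence "c \<in> set (cols A)" using A s by (auto simp: cols_def)
    ultimately show ?thesis by simp
  qed
  finally have "rank ?P \<le> rank A"
    using P(1) by (intro rank_mono[OF _ A, of _ "Suc s"] span_is_monotone) auto
  moreover have "rank ?P = Suc s" using rank_append_col[OF P(1) c(1)] c(2) P(2) by simp
  ultimately show thesis using s by (intro that[OF A]) (auto simp: A_def)
qed

text \<open>The rank \<open>s\<close> of \<open>X\<close> satisfies \<open>s <= r < min m n\<close>,
  so there is room for an independent extra column and row, and index \<open>r\<close> exists in
  both directions. The strict increase of both ranks drives the induction that follows.\<close>

lemma star_mult_decompose:
  fixes X :: "'a :: field mat"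
  assumes r: "r < min m n" and X: "X \<in> carrier_mat m n" and le: "vec_space.rank m X \<le> r"
  obtains A B where "A \<in> carrier_mat m n" "B \<in> carrier_mat m n"
    "vec_space.rank m A > vec_space.rank m X" "vec_space.rank m B > vec_space.rank m X"
    "X = star_mult m n r A B"
proof -
  define s where "s = vec_space.rank m X"
  have s: "s \<le> r" "s < m" "s < n" "r < m" "r < n" using r le by (auto simp: s_def)
  obtain P Q where P: "P \<in> carrier_mat m s" and Q: "Q \<in> carrier_mat s n" and PQ: "X = P * Q"
    using vec_space.rank_factorization[OF X] unfolding s_def .
  \<comment> \<open>Both factors have full rank \<open>s\<close>: the rank of the product bounds
    theirs from below, their format from above.\<close>
  have "s \<le> vec_space.rank m P"
    using vec_space.rank_mult_le_left[OF P Q] by (simp add: s_def PQ)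
  hence rP: "vec_space.rank m P = s" using vec_space.rank_le_nc[OF P] by simp
  have Qt: "Q\<^sup>T \<in> carrier_mat n s" using Q by simp
  have "s \<le> vec_space.rank n Q\<^sup>T"
    using rank_mult_le_right[OF P Q] rank_transpose[OF Q] by (simp add: s_def PQ)
  hence rQ: "vec_space.rank n Q\<^sup>T = s" using vec_space.rank_le_nc[OF Qt] by simp
  obtain A where A: "A \<in> carrier_mat m n" "vec_space.rank m A > s"
    "\<And>i j. i < m \<Longrightarrow> j < r \<Longrightarrow> A $$ (i, j) = (if j < s then P $$ (i, j) else 0)"
    using vec_space.pad_with_independent_col[OF P rP s(2,1,5)] by metis
  \<comment> \<open>Padding the transpose of \<open>Q\<close> by a column amounts to padding
    \<open>Q\<close> by a row, so the right factor is the transpose of \<open>B\<close>.\<close>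
  obtain B where B: "B \<in> carrier_mat n m" "vec_space.rank n B > s"
    "\<And>i j. i < n \<Longrightarrow> j < r \<Longrightarrow> B $$ (i, j) = (if j < s then Q\<^sup>T $$ (i, j) else 0)"
    using vec_space.pad_with_independent_col[OF Qt rQ s(3,1,4)] by metis
  have Bt: "B\<^sup>T \<in> carrier_mat m n" using B by simp
  have "star_mult m n r A B\<^sup>T = P * Q"
  proof (rule eq_matI)
    fix i j assume "i < dim_row (P * Q)" "j < dim_col (P * Q)"
    hence ij: "i < m" "j < n" using P Q by auto
    have "star_mult m n r A B\<^sup>T $$ (i, j) = (\<Sum>k<r. A $$ (i, k) * B $$ (j, k))"
      using star_mult_eq[OF _ A(1) Bt] ij B(1) s
      by (simp add: scalar_prod_def lessThan_atLeast0)
    \<comment> \<open>The terms with \<open>s <= k < r\<close> vanish by the zero padding.\<close>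
    also have "\<dots> = (\<Sum>k<s. P $$ (i, k) * Q $$ (k, j))"
      using ij s Q by (intro sum.mono_neutral_cong_right) (auto simp: A(3) B(3))
    also have "\<dots> = (P * Q) $$ (i, j)"
      using ij P Q by (simp add: scalar_prod_def lessThan_atLeast0)
    finally show "star_mult m n r A B\<^sup>T $$ (i, j) = (P * Q) $$ (i, j)" .
  qed (use A Bt P Q in \<open>auto simp: star_mult_def\<close>)
  moreover have "vec_space.rank m B\<^sup>T > s" using B(2) rank_transpose[OF B(1)] by simp
  ultimately show thesis using that A Bt PQ unfolding s_def by metis
qed

lemma Omega_generates:
  assumes r: "r < min m n"
  shows "generates_semigroup (carrier_mat m n :: 'a :: field mat set) (star_mult m n r) (Omega m n r)"
proof -
  let ?G = "semigroup_generate (star_mult m n r) (Omega m n r) :: 'a mat set"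
  have sub: "Omega m n r \<subseteq> (carrier_mat m n :: 'a mat set)" by (auto simp: Omega_def)
  have "X \<in> carrier_mat m n" if "X \<in> ?G" for X
    using that by induction (use sub star_mult_closed in auto)
  moreover have "X \<in> ?G" if "X \<in> carrier_mat m n" for X
    using that
  \<comment> \<open>This measure is 0 exactly on \<open>Omega\<close> and falls strictly when the
    rank rises from a value at most \<open>r\<close>, so it encodes downward induction on the
    rank.\<close>
  proof (induction "Suc r - vec_space.rank m X" arbitrary: X rule: less_induct)
    case less
    show ?case
    proof (cases "vec_space.rank m X > r")
      case True
      thus ?thesis using less.prems by (auto simp: Omega_def intro: semigroup_generate.incl)
    next
      case False
      then obtain A B where AB: "A \<in> carrier_mat m n" "B \<in> carrier_mat m n"
        "vec_space.rank m A > vec_space.rank m X" "vec_space.rank m B > vec_space.rank m X"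
        "X = star_mult m n r A B"
        using star_mult_decompose[OF r less.prems] by (metis not_less)
      have "A \<in> ?G" "B \<in> ?G" using less.hyps AB(1-4) False by auto
      thus ?thesis using AB(5) semigroup_generate.mult by metis
    qed
  qed
  ultimately show ?thesis using sub by (auto simp: generates_semigroup_def)
qed

text \<open>A generated element is a generator or a product, and products have rank at most
  \<open>r\<close>.\<close>

lemma Omega_subset_generating_set:
  assumes r: "r \<le> min m n"
    and gen: "generates_semigroup (carrier_mat m n :: 'a :: field mat set) (star_mult m n r) A"
  shows "Omega m n r \<subseteq> A"
proof
  fix X :: "'a mat" assume X: "X \<in> Omega m n r"
  have G: "semigroup_generate (star_mult m n r) A = carrier_mat m n"
    using gen by (simp add: generates_semigroup_def)
  have "X \<in> semigroup_generate (star_mult m n r) A" using X G by (auto simp: Omega_def)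
  thus "X \<in> A"
  proof cases
    case (mult Y Z)
    hence "vec_space.rank m X \<le> r" using rank_star_mult_le[OF r] G by auto
    thus ?thesis using X by (simp add: Omega_def)
  qed
qed

section \<open>Size of the least generating set\<close>

lemma semigroup_rank_eqI:
  assumes "generates_semigroup S opr B" "finite B"
    and "\<And>A. generates_semigroup S opr A \<Longrightarrow> B \<subseteq> A"
  shows "semigroup_rank S opr = card B"
  \<comment> \<open>The definition ranges over finite \<open>A\<close> only, so the inclusion of
    \<open>B\<close> in \<open>A\<close> bounds the cardinality.\<close>
  unfolding semigroup_rank_def using assms by (intro Least_equality) (auto intro: card_mono)

lemma card_Omega_eq:
  fixes m n r :: nat
  assumes fin: "finite (UNIV :: 'a :: field set)"
  defines "q \<equiv> real (card (UNIV :: 'a set))"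
  shows "real (card (Omega m n r :: 'a mat set)) =
    (\<Sum>s=r+1..min m n. q_binomial q m s * q_binomial q n s
       * q ^ (s choose 2) * (q - 1) ^ s * q_fact q s)"
proof -
  let ?R = "\<lambda>s. {X \<in> carrier_mat m n :: 'a mat set. vec_space.rank m X = s}"
  have "vec_space.rank m X \<le> min m n" if X: "X \<in> carrier_mat m n" for X :: "'a mat"
    using vec_space.rank_le_nc[OF X] vec_space.rank_le_nc[of "X\<^sup>T" n m] rank_transpose[OF X] X by simp
  \<comment> \<open>The upper limit \<open>min m n\<close> comes from bounding the rank by the
    number of columns of the matrix and of its transpose.\<close>
  hence "Omega m n r = (\<Union>s\<in>{r+1..min m n}. ?R s)" by (fastforce simp: Omega_def)
  moreover have "finite (?R s)" for s
    using finite_carrier_mat[OF fin, of m n] by (rule rev_finite_subset) simp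
  ultimately have "card (Omega m n r :: 'a mat set) = (\<Sum>s=r+1..min m n. card (?R s))"
    by (simp only:) (rule card_UN_disjoint, auto)
  hence "real (card (Omega m n r :: 'a mat set)) = (\<Sum>s=r+1..min m n. real (card (?R s)))"
    by simp
  also have "\<dots> = (\<Sum>s=r+1..min m n. q_binomial q m s * q_binomial q n s
       * q ^ (s choose 2) * (q - 1) ^ s * q_fact q s)"
  proof (rule sum.cong)
    fix s assume "s \<in> {r+1..min m n}"
    hence s: "s \<le> m" "s \<le> n" by auto
    have "q \<ge> 0" by (simp add: q_def)
    thus "real (card (?R s)) = q_binomial q m s * q_binomial q n s
       * q ^ (s choose 2) * (q - 1) ^ s * q_fact q s"
      \<comment> \<open>The count supplies the binomial in \<open>n\<close>; rewriting its product
        supplies the binomial in \<open>m\<close> and the remaining factors.\<close>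
      using vec_space.card_rank_eq[OF fin s(2), of m] prod_diff_powers_eq[OF _ s(1), of q]
      by (simp add: q_def mult_ac)
  qed simp
  finally show ?thesis .
qed

theorem theorem4p12:
  fixes m n r :: nat
  assumes "m \<ge> 1" and "n \<ge> 1" and "r < min m n"
  shows "generates_semigroup (carrier_mat m n :: 'a :: field mat set) (star_mult m n r) (Omega m n r)
    \<and> (\<forall>A. generates_semigroup (carrier_mat m n :: 'a mat set) (star_mult m n r) A \<longrightarrow>
            Omega m n r \<subseteq> A)
    \<and> (\<forall>q. finite (UNIV :: 'a set) \<and> card (UNIV :: 'a set) = q \<longrightarrow>
         semigroup_rank (carrier_mat m n :: 'a mat set) (star_mult m n r)
           = card (Omega m n r :: 'a mat set)
         \<and> real (card (Omega m n r :: 'a mat set))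
           = (\<Sum>s=r+1..min m n. q_binomial (real q) m s * q_binomial (real q) n s
                * real q ^ (s choose 2) * (real q - 1) ^ s * q_fact (real q) s))"
proof (intro conjI allI impI)
  have r: "r \<le> min m n" using assms by simp
  show gen: "generates_semigroup (carrier_mat m n :: 'a mat set) (star_mult m n r) (Omega m n r)"
    using assms by (intro Omega_generates)
  show sub: "Omega m n r \<subseteq> A"
    if "generates_semigroup (carrier_mat m n :: 'a mat set) (star_mult m n r) A" for A
    using Omega_subset_generating_set[OF r that] .
  fix q assume q: "finite (UNIV :: 'a set) \<and> card (UNIV :: 'a set) = q"
  have fin: "finite (UNIV :: 'a set)" using q ..
  have "finite (Omega m n r :: 'a mat set)"
    using finite_carrier_mat[OF fin, of m n] by (rule rev_finite_subset) (simp add: Omega_def)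
  from semigroup_rank_eqI[OF gen this sub]
  show "semigroup_rank (carrier_mat m n :: 'a mat set) (star_mult m n r)
      = card (Omega m n r :: 'a mat set)" .
  show "real (card (Omega m n r :: 'a mat set))
      = (\<Sum>s=r+1..min m n. q_binomial (real q) m s * q_binomial (real q) n s
           * real q ^ (s choose 2) * (real q - 1) ^ s * q_fact (real q) s)"
    using card_Omega_eq[OF fin, of m n r] q by simp
qed

end
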